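(* Let $n\in\mathbb{N}$ and let $$u_n(x_1,x_2,x_3)=\frac{n\,H_{n-1}^{(3)}(x_1,x_2,x_3)}{H_n^{(3)}(x_1,x_2,x_3)}.$$ Then for all $(x_1,x_2,x_3)\in\mathbb{R}^3$ (at which $u_n$ is defined, i.e. $H_n^{(3)}(x_1,x_2,x_3)\neq 0$) the following partial differential equations hold: $$\frac{\partial u_n}{\partial x_3}=\frac{\partial}{\partial x_1}\left(\frac{\partial}{\partial x_1}+u_n\right)^{2}u_n ,$$ $$\frac{\partial u_n}{\partial x_2}=\frac{\partial}{\partial x_1}\left(\frac{\partial}{\partial x_1}+u_n\right)u_n .$$
   Context: Here $\mathbb{N}=\{1,2,3,\dots\}$. The two-variable Hermite polynomials are $$H_n(x,y)=n!\sum_{r=0}^{\lfloor n/2\rfloor}\frac{y^r x^{n-2r}}{(n-2r)!\,r!},\qquad n\ge 0,$$ and the (complete, non-lacunary) third order Hermite polynomials are $$H_n^{(3)}(x_1,x_2,x_3)=n!\sum_{r=0}^{\lfloor n/3\rfloor}\frac{H_{n-3r}(x_1,x_2)\,x_3^r}{(n-3r)!\,r!},\qquad n\ge 0.$$ The expression $\frac{\partial}{\partial x_1}+u_n$ denotes the differential operator $f\mapsto \frac{\partial f}{\partial x_1}+u_n f$ (with $u_n$ acting by multiplication), and powers denote composition of operators; thus $\left(\frac{\partial}{\partial x_1}+u_n\right)^{2}u_n$ is this operator applied twice to the function $u_n$. *)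

theory Defs
  imports "HOL-Analysis.Analysis"
begin

definition hermite2 :: "nat \<Rightarrow> real \<Rightarrow> real \<Rightarrow> real" where
  "hermite2 n x y =
     fact n * (\<Sum>r = 0..n div 2. y ^ r * x ^ (n - 2 * r) / (fact (n - 2 * r) * fact r))"

definition hermite3 :: "nat \<Rightarrow> real \<Rightarrow> real \<Rightarrow> real \<Rightarrow> real" where
  "hermite3 n x1 x2 x3 =
     fact n * (\<Sum>r = 0..n div 3. hermite2 (n - 3 * r) x1 x2 * x3 ^ r / (fact (n - 3 * r) * fact r))"

(* Division by zero makes u n total, with value 0 on the zero set of hermite3 n.  That set is
   closed, so derivatives at points outside it do not depend on this convention. *)
definition u :: "nat \<Rightarrow> real \<Rightarrow> real \<Rightarrow> real \<Rightarrow> real" where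
  "u n x1 x2 x3 = real n * hermite3 (n - 1) x1 x2 x3 / hermite3 n x1 x2 x3"

(* deriv is total: a value of pd1, pd2 or pd3 is meaningful only together with differentiability
   of the corresponding one-variable slice. *)
definition pd1 :: "(real \<Rightarrow> real \<Rightarrow> real \<Rightarrow> real) \<Rightarrow> real \<Rightarrow> real \<Rightarrow> real \<Rightarrow> real" where
  "pd1 f x1 x2 x3 = deriv (\<lambda>t. f t x2 x3) x1"

definition pd2 :: "(real \<Rightarrow> real \<Rightarrow> real \<Rightarrow> real) \<Rightarrow> real \<Rightarrow> real \<Rightarrow> real \<Rightarrow> real" where
  "pd2 f x1 x2 x3 = deriv (\<lambda>t. f x1 t x3) x2"

definition pd3 :: "(real \<Rightarrow> real \<Rightarrow> real \<Rightarrow> real) \<Rightarrow> real \<Rightarrow> real \<Rightarrow> real \<Rightarrow> real" where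
  "pd3 f x1 x2 x3 = deriv (\<lambda>t. f x1 x2 t) x3"

definition pd1_plus ::
  "(real \<Rightarrow> real \<Rightarrow> real \<Rightarrow> real) \<Rightarrow> (real \<Rightarrow> real \<Rightarrow> real \<Rightarrow> real) \<Rightarrow> real \<Rightarrow> real \<Rightarrow> real \<Rightarrow> real" where
  "pd1_plus w f = (\<lambda>x1 x2 x3. pd1 f x1 x2 x3 + w x1 x2 x3 * f x1 x2 x3)"

end

(* Dividing hermite3 n by n! gives polynomials h_n for which d/dx_j lowers the index n by j.
   Hence d/dx_2 and d/dx_3 act on h_n as the second and third powers of d/dx_1.
   Writing D_k for the k-th x_1-derivative of h_n, one has u_n = D_1 / D_0, and the quotient rule
   gives (d/dx_1 + u_n) (D_k / D_0) = D_(k+1) / D_0.  Both equations thus reduce to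
   (d/dx_j) (D_1 / D_0) = (d/dx_1) (D_j / D_0). *)
theory Submission
  imports Defs
begin

text \<open>On generating functions this is multiplication by z^j. The explicit zero matters: for
  \<open>m < j\<close> truncated subtraction would return \<open>a 0\<close>.\<close>

definition shift :: "nat \<Rightarrow> (nat \<Rightarrow> real) \<Rightarrow> nat \<Rightarrow> real" where
  "shift j a m = (if m < j then 0 else a (m - j))"

text \<open>For \<open>k > 0\<close>, the coefficient of z^m in A(z) C(z^k), where \<open>a\<close>
  and \<open>c\<close> are the coefficient sequences of A and C.\<close>

definition conv :: "nat \<Rightarrow> (nat \<Rightarrow> real) \<Rightarrow> (nat \<Rightarrow> real) \<Rightarrow> nat \<Rightarrow> real" where
  "conv k a c m = (\<Sum>r = 0..m div k. a (m - k * r) * c r)"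

definition divided_power :: "real \<Rightarrow> nat \<Rightarrow> real" where
  "divided_power x m = x ^ m / fact m"

lemma shift_shift: "shift i (shift j a) m = shift (i + j) a m"
  by (auto simp: shift_def add.commute)

lemma shift_add: "j \<le> m \<Longrightarrow> shift i a (m - j) = shift (i + j) a m"
  using shift_shift[of j i a m] by (simp add: shift_def add.commute)

lemma conv_shift_left:
  assumes "k > 0"
  shows "conv k (shift j a) c m = shift j (conv k a c) m"
proof (cases "m < j")
  case True
  then have "shift j a (m - k * r) = 0" for r
    by (auto simp: shift_def)
  with True show ?thesis
    by (simp add: conv_def shift_def)
next
  case False
  have "(\<Sum>r = 0..m div k. shift j a (m - k * r) * c r)
      = (\<Sum>r = 0..(m - j) div k. a (m - j - k * r) * c r)"
  proof (rule sum.mono_neutral_cong_right)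
    show "{0..(m - j) div k} \<subseteq> {0..m div k}"
      by (auto simp: div_le_mono intro: order_trans)
    \<comment> \<open>The discarded r have k * r > m - j, so the index m - k * r is below j, where
      \<open>shift\<close> is zero.\<close>
    show "\<forall>r\<in>{0..m div k} - {0..(m - j) div k}. shift j a (m - k * r) * c r = 0"
      using assms False
      by (auto simp: shift_def less_eq_div_iff_mult_less_eq mult.commute not_le)
    fix r assume "r \<in> {0..(m - j) div k}"
    then have "k * r \<le> m - j"
      using assms by (simp add: less_eq_div_iff_mult_less_eq mult.commute)
    with False show "shift j a (m - k * r) * c r = a (m - j - k * r) * c r"
      by (auto simp: shift_def add.commute)
  qed simp
  with False show ?thesis
    by (simp add: conv_def shift_def)
qed

text \<open>A factor w of C(w) becomes z^k under w = z^k. In coefficients, the term r = 0 vanishes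
  and the others are reindexed by one.\<close>

lemma conv_shift_right:
  assumes "k > 0"
  shows "conv k a (shift 1 c) m = shift k (conv k a c) m"
proof (cases "m < k")
  case True
  then show ?thesis
    by (simp add: conv_def shift_def)
next
  case False
  then have "m div k = Suc ((m - k) div k)"
    using assms by (simp add: le_div_geq)
  then show ?thesis
    using False by (simp add: conv_def shift_def sum.atLeast0_atMost_Suc_shift o_def
        del: sum.cl_ivl_Suc)
qed

text \<open>Coefficientwise form of d/dx exp(x z) = z exp(x z).\<close>

lemma DERIV_divided_power:
  "((\<lambda>x. divided_power x m) has_real_derivative shift 1 (divided_power x) m) (at x)"
  using DERIV_cdivide[OF DERIV_pow[of m x], of "fact m"]
  by (cases m) (auto simp: divided_power_def shift_def simp del: of_nat_Suc)

lemma DERIV_conv_left: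
  assumes "k > 0"
    and "\<And>m. ((\<lambda>x. a x m) has_real_derivative shift j (a x) m) (at x)"
  shows "((\<lambda>x. conv k (a x) c m) has_real_derivative shift j (conv k (a x) c) m) (at x)"
  unfolding conv_shift_left[OF assms(1), symmetric] unfolding conv_def
  by (auto intro!: derivative_eq_intros assms(2))

lemma DERIV_conv_right:
  assumes "k > 0"
    and "\<And>m. ((\<lambda>x. c x m) has_real_derivative shift 1 (c x) m) (at x)"
  shows "((\<lambda>x. conv k a (c x) m) has_real_derivative shift k (conv k a (c x)) m) (at x)"
  unfolding conv_shift_right[OF assms(1), symmetric] unfolding conv_def
  by (auto intro!: derivative_eq_intros assms(2) simp: mult.commute)

definition scaled_hermite2 :: "real \<Rightarrow> real \<Rightarrow> nat \<Rightarrow> real" where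
  "scaled_hermite2 x y = conv 2 (divided_power x) (divided_power y)"

text \<open>The coefficients of exp(x1 z + x2 z^2 + x3 z^3), which explains why differentiation in
  x_j shifts by j.\<close>

definition scaled_hermite3 :: "real \<Rightarrow> real \<Rightarrow> real \<Rightarrow> nat \<Rightarrow> real" where
  "scaled_hermite3 x1 x2 x3 = conv 3 (scaled_hermite2 x1 x2) (divided_power x3)"

lemma hermite2_eq: "hermite2 n x y = fact n * scaled_hermite2 x y n"
  by (simp add: hermite2_def scaled_hermite2_def conv_def divided_power_def mult.commute)

lemma hermite3_eq: "hermite3 n x1 x2 x3 = fact n * scaled_hermite3 x1 x2 x3 n"
  by (simp add: hermite3_def scaled_hermite3_def conv_def divided_power_def hermite2_eq)

lemma DERIV_scaled_hermite3_1:
  "((\<lambda>t. scaled_hermite3 t x2 x3 m) has_real_derivative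
     shift 1 (scaled_hermite3 x1 x2 x3) m) (at x1)"
  unfolding scaled_hermite3_def scaled_hermite2_def
  by (intro DERIV_conv_left DERIV_divided_power) auto

text \<open>The variable x2 sits in the right factor of the inner \<open>conv 2\<close>, which
  produces the shift by 2; this shift then passes through the left factor of the outer
  \<open>conv 3\<close>.\<close>

lemma DERIV_scaled_hermite3_2:
  "((\<lambda>t. scaled_hermite3 x1 t x3 m) has_real_derivative
     shift 2 (scaled_hermite3 x1 x2 x3) m) (at x2)"
  unfolding scaled_hermite3_def scaled_hermite2_def
  by (intro DERIV_conv_left DERIV_conv_right DERIV_divided_power) auto

lemma DERIV_scaled_hermite3_3:
  "((\<lambda>t. scaled_hermite3 x1 x2 t m) has_real_derivative
     shift 3 (scaled_hermite3 x1 x2 x3) m) (at x3)"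
  unfolding scaled_hermite3_def
  by (intro DERIV_conv_right DERIV_divided_power) auto

lemma DERIV_shift:
  assumes "\<And>m. ((\<lambda>t. a t m) has_real_derivative shift i (a x) m) (at x)"
  shows "((\<lambda>t. shift j (a t) m) has_real_derivative shift (i + j) (a x) m) (at x)"
proof (cases "m < j")
  case True
  then show ?thesis
    by (simp add: shift_def)
next
  case False
  with assms[of "m - j"] show ?thesis
    by (simp add: shift_add) (simp add: shift_def)
qed

lemma DERIV_shift_quotient:
  assumes "\<And>m. ((\<lambda>t. a t m) has_real_derivative shift i (a x) m) (at x)" and "a x n \<noteq> 0"
  shows "((\<lambda>t. shift j (a t) n / a t n) has_real_derivative
     (shift (i + j) (a x) n * a x n - shift j (a x) n * shift i (a x) n) / (a x n)\<^sup>2) (at x)"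
  using DERIV_divide[OF DERIV_shift[OF assms(1)] assms(1) assms(2)]
  by (simp add: power2_eq_square)

text \<open>The factorials cancel by n (n-1)! = n!. Where the denominator vanishes both sides are 0,
  so the equation holds at every point and can be used under a binder.\<close>

lemma u_eq:
  assumes "n \<ge> 1"
  shows "u n x1 x2 x3 = shift 1 (scaled_hermite3 x1 x2 x3) n / scaled_hermite3 x1 x2 x3 n"
  using assms by (cases n) (auto simp: u_def hermite3_eq shift_def)

text \<open>Off the zero set \<open>f\<close> is a known quotient; on it, \<open>f\<close> may
  involve unspecified values of \<open>deriv\<close>. Non-vanishing is an open condition by
  continuity, so the two agree near x1 and the derivative carries over.\<close>

lemma DERIV_slice_1:
  assumes "\<And>t. scaled_hermite3 t x2 x3 n \<noteq> 0 \<Longrightarrow>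
      f t x2 x3 = shift j (scaled_hermite3 t x2 x3) n / scaled_hermite3 t x2 x3 n"
    and "scaled_hermite3 x1 x2 x3 n \<noteq> 0"
  shows "((\<lambda>t. f t x2 x3) has_real_derivative
     (shift (1 + j) (scaled_hermite3 x1 x2 x3) n * scaled_hermite3 x1 x2 x3 n
       - shift j (scaled_hermite3 x1 x2 x3) n * shift 1 (scaled_hermite3 x1 x2 x3) n)
     / (scaled_hermite3 x1 x2 x3 n)\<^sup>2) (at x1)"
proof -
  have "eventually (\<lambda>t. scaled_hermite3 t x2 x3 n \<noteq> 0) (nhds x1)"
  proof -
    have "isCont (\<lambda>t. scaled_hermite3 t x2 x3 n) x1"
      using DERIV_scaled_hermite3_1 by (rule DERIV_isCont)
    then have "((\<lambda>t. scaled_hermite3 t x2 x3 n) \<longlongrightarrow> scaled_hermite3 x1 x2 x3 n) (nhds x1)"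
      using tendsto_at_iff_tendsto_nhds[of "\<lambda>t. scaled_hermite3 t x2 x3 n" x1]
      by (simp add: isCont_def)
    then show ?thesis
      using assms(2) by (rule tendsto_imp_eventually_ne)
  qed
  then have "eventually (\<lambda>t. f t x2 x3
      = shift j (scaled_hermite3 t x2 x3) n / scaled_hermite3 t x2 x3 n) (nhds x1)"
    by eventually_elim (rule assms(1))
  from DERIV_cong_ev[OF refl this refl] show ?thesis
    using DERIV_shift_quotient[OF DERIV_scaled_hermite3_1 assms(2)] by blast
qed

lemma pd1_plus_funpow_u:
  assumes "n \<ge> 1" and "scaled_hermite3 x1 x2 x3 n \<noteq> 0"
  shows "(pd1_plus (u n) ^^ k) (u n) x1 x2 x3
    = shift (Suc k) (scaled_hermite3 x1 x2 x3) n / scaled_hermite3 x1 x2 x3 n"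
  using assms(2)
\<comment> \<open>Differentiating in x1 needs the induction hypothesis at nearby points of the
  slice, hence the generalization.\<close>
proof (induction k arbitrary: x1)
  case 0
  show ?case
    using u_eq[OF assms(1)] by simp
next
  case (Suc k)
  let ?f = "(pd1_plus (u n) ^^ k) (u n)"
  note d = DERIV_slice_1[where f = ?f, OF Suc.IH Suc.prems]
  note u_value = u_eq[OF assms(1), of x1 x2 x3]
  have "(pd1_plus (u n) ^^ Suc k) (u n) x1 x2 x3
      = deriv (\<lambda>t. ?f t x2 x3) x1 + u n x1 x2 x3 * ?f x1 x2 x3"
    by (simp add: pd1_plus_def[of _ ?f] pd1_def)
  \<comment> \<open>With D_k as above, the quotient rule leaves - D_(k+1) D_1 / D_0^2, which the
    product with u_n cancels.\<close>
  also have "\<dots> = shift (Suc (Suc k)) (scaled_hermite3 x1 x2 x3) n / scaled_hermite3 x1 x2 x3 n"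
    using Suc.prems
    by (simp add: DERIV_imp_deriv[OF d] Suc.IH u_value power2_eq_square field_simps)
  finally show ?case .
qed

theorem proposition2p1:
  fixes n :: nat and x1 x2 x3 :: real
  assumes "n \<ge> 1"
    and "hermite3 n x1 x2 x3 \<noteq> 0"
  shows "(\<lambda>t. u n x1 x2 t) differentiable (at x3) \<and>
         (\<lambda>t. u n x1 t x3) differentiable (at x2) \<and>
         (\<forall>k\<le>2. (\<lambda>t. (pd1_plus (u n) ^^ k) (u n) t x2 x3) differentiable (at x1)) \<and>
         pd3 (u n) x1 x2 x3 = pd1 ((pd1_plus (u n) ^^ 2) (u n)) x1 x2 x3 \<and>
         pd2 (u n) x1 x2 x3 = pd1 (pd1_plus (u n) (u n)) x1 x2 x3"
proof -
  have nz: "scaled_hermite3 x1 x2 x3 n \<noteq> 0"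
    using assms(2) by (simp add: hermite3_eq)
  note d1 = DERIV_slice_1[where f = "(pd1_plus (u n) ^^ k) (u n)" for k, OF pd1_plus_funpow_u[OF assms(1)] nz]
  note d2 = DERIV_shift_quotient[OF DERIV_scaled_hermite3_2 nz, of 1,
      folded u_eq[OF assms(1)]]
  note d3 = DERIV_shift_quotient[OF DERIV_scaled_hermite3_3 nz, of 1,
      folded u_eq[OF assms(1)]]
  \<comment> \<open>Both sides equal (D_4 D_0 - D_1 D_3) / D_0^2.\<close>
  have "pd3 (u n) x1 x2 x3 = pd1 ((pd1_plus (u n) ^^ 2) (u n)) x1 x2 x3"
    using DERIV_imp_deriv[OF d3] DERIV_imp_deriv[OF d1[of 2]]
    by (simp add: pd1_def pd3_def mult.commute)
  \<comment> \<open>Both sides equal (D_3 D_0 - D_1 D_2) / D_0^2.\<close>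
  moreover have "pd2 (u n) x1 x2 x3 = pd1 (pd1_plus (u n) (u n)) x1 x2 x3"
    using DERIV_imp_deriv[OF d2] DERIV_imp_deriv[OF d1[of 1]]
    by (simp add: pd1_def pd2_def mult.commute numeral_2_eq_2)
  ultimately show ?thesis
    unfolding real_differentiable_def using d1 d2 d3 by blast
qed

end
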